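(* Let $\mathcal{H}$ be a separable infinite-dimensional Hilbert space with orthonormal basis $\{e_j\}_{j\in\mathbb{N}}$, and let $U,W\in B(\mathcal{H})$ be such that $W$ is invertible and $U$ is unitary. For $m\in\mathbb{N}$ let $P_m$ be the orthogonal projection of $\mathcal{H}$ onto $\mathrm{span}\{e_1,\ldots,e_m\}$. Suppose that for each $m\in\mathbb{N}$ there is a strictly increasing sequence $\{n_k\}\subseteq\mathbb{N}$ such that $$\lim_{k\to\infty}\sum_{l=1}^\infty\|W^{ln_k}P_m\|=\lim_{k\to\infty}\sum_{l=1}^\infty\|W^{-ln_k}P_m\|=0,$$ where the corresponding series are convergent for each $k$. Then the operators $T_{U,W}$ and $S_{U,W}$ are chaotic on $B_0(\mathcal{H})$.
   Context: $B(\mathcal{H})$ is the space of bounded linear operators on $\mathcal{H}$ and $B_0(\mathcal{H})$ the space of compact operators with the operator norm. $T_{U,W}(F):=WFU$ and $S_{U,W}(F):=T_{U,W}^{-1}(F)=W^{-1}FU^{-1}$. A sequence $(T_n)_{n\in\mathbb{N}_0}$ of bounded operators on a Banach space $\mathcal{X}$ is topologically transitive if for all non-empty open $A,B\subseteq\mathcal{X}$ there is $n\in\mathbb{N}$ with $T_n(A)\cap B\neq\varnothing$. A vector $x$ is a periodic element of $(T_n)$ if there is $N\in\mathbb{N}$ such that $T_{kN}x=x$ for every $k\in\mathbb{N}$. The sequence $(T_n)$ is chaotic if it is topologically transitive and its set of periodic elements is dense in $\mathcal{X}$. A bounded operator $T$ is chaotic if the sequence $(T^n)_{n\in\mathbb{N}_0}$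 is chaotic. *)

theory Defs
  imports "HOL-Analysis.Analysis"
begin

section \<open>Complex Hilbert spaces\<close>

class complex_vector = real_vector +
  fixes scaleC :: "complex \<Rightarrow> 'a \<Rightarrow> 'a"  (infixr \<open>*\<^sub>C\<close> 75)
  assumes scaleC_add_right: "c *\<^sub>C (x + y) = c *\<^sub>C x + c *\<^sub>C y"
    and scaleC_add_left: "(c + d) *\<^sub>C x = c *\<^sub>C x + d *\<^sub>C x"
    and scaleC_scaleC: "c *\<^sub>C d *\<^sub>C x = (c * d) *\<^sub>C x"
    and scaleC_one: "1 *\<^sub>C x = x"
    and scaleR_scaleC: "r *\<^sub>R x = complex_of_real r *\<^sub>C x"

class complex_normed_vector = complex_vector + real_normed_vector +
  assumes norm_scaleC: "norm (c *\<^sub>C x) = cmod c * norm x"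

text \<open>The inner product is linear in its first argument. The norm laws inherited from
  \<^class>\<open>complex_normed_vector\<close> are consequences of the axioms below, so they restrict nothing.\<close>

class complex_inner = complex_normed_vector +
  fixes cinner :: "'a \<Rightarrow> 'a \<Rightarrow> complex"
  assumes cinner_add_left: "cinner (x + y) z = cinner x z + cinner y z"
    and cinner_scaleC_left: "cinner (c *\<^sub>C x) y = c * cinner x y"
    and cinner_commute: "cinner x y = cnj (cinner y x)"
    and cinner_ge_zero: "0 \<le> Re (cinner x x)"
    and cinner_eq_zero_iff: "cinner x x = 0 \<longleftrightarrow> x = 0"
    and norm_eq_sqrt_cinner: "norm x = sqrt (Re (cinner x x))"

class chilbert_space = complex_inner + banach

global_interpretation complex_vector:
  vector_space "scaleC :: complex \<Rightarrow> 'a \<Rightarrow> 'a :: complex_vector"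
  defines cspan = complex_vector.span
    and csubspace = complex_vector.subspace
  by unfold_locales (simp_all add: scaleC_add_right scaleC_add_left scaleC_scaleC scaleC_one)

definition orthonormal_basis :: "(nat \<Rightarrow> 'a::complex_inner) \<Rightarrow> nat set \<Rightarrow> bool" where
  "orthonormal_basis e J \<longleftrightarrow>
     (\<forall>i\<in>J. \<forall>j\<in>J. cinner (e i) (e j) = (if i = j then 1 else 0)) \<and>
     closure (cspan (e ` J)) = UNIV"

definition infinite_dimensional :: "'a::complex_vector itself \<Rightarrow> bool" where
  "infinite_dimensional _ \<longleftrightarrow> \<not> (\<exists>B::'a set. finite B \<and> cspan B = UNIV)"


section \<open>Bounded and compact operators\<close>

text \<open>The type of bounded real-linear maps into a complex normed space is itself a complex normed
  space under pointwise scaling. The bounded complex-linear operators form a complex subspace of it,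
  on which its norm is the usual operator norm.\<close>

instantiation blinfun :: (real_normed_vector, complex_normed_vector) complex_normed_vector
begin

lift_definition scaleC_blinfun :: "complex \<Rightarrow> 'a \<Rightarrow>\<^sub>L 'b \<Rightarrow> 'a \<Rightarrow>\<^sub>L 'b"
  is "\<lambda>c F x. c *\<^sub>C F x"
proof -
  fix c :: complex and F :: "'a \<Rightarrow> 'b"
  assume "bounded_linear F"
  moreover have "bounded_linear (\<lambda>y::'b. c *\<^sub>C y)"
    by (rule bounded_linear_intro[where K = "cmod c"])
      (simp_all add: scaleC_add_right scaleR_scaleC scaleC_scaleC norm_scaleC mult.commute)
  ultimately show "bounded_linear (\<lambda>x. c *\<^sub>C F x)"
    using bounded_linear_compose by blast
qed

instance
proof
  fix c d :: complex and r :: real and F G :: "'a \<Rightarrow>\<^sub>L 'b"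
  show "c *\<^sub>C (F + G) = c *\<^sub>C F + c *\<^sub>C G" "(c + d) *\<^sub>C F = c *\<^sub>C F + d *\<^sub>C F"
    "c *\<^sub>C d *\<^sub>C F = (c * d) *\<^sub>C F" "1 *\<^sub>C F = F" "r *\<^sub>R F = complex_of_real r *\<^sub>C F"
    by (transfer; simp add: fun_eq_iff scaleC_add_right scaleC_add_left scaleC_scaleC scaleC_one
        scaleR_scaleC)+
  have le: "norm (a *\<^sub>C H) \<le> cmod a * norm H" for a and H :: "'a \<Rightarrow>\<^sub>L 'b"
  proof (rule norm_blinfun_bound)
    fix x
    show "norm ((a *\<^sub>C H) x) \<le> cmod a * norm H * norm x"
      using mult_left_mono[OF norm_blinfun[of H x], of "cmod a"]
      by (simp add: scaleC_blinfun.rep_eq norm_scaleC mult.assoc)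
  qed simp
  show "norm (c *\<^sub>C F) = cmod c * norm F"
  proof (cases "c = 0")
    case True
    then show ?thesis using le[of 0 F] by simp
  next
    case False
    have "inverse c *\<^sub>C c *\<^sub>C F = F"
      using False by (transfer; simp add: fun_eq_iff scaleC_scaleC scaleC_one)
    then have "norm F \<le> inverse (cmod c) * norm (c *\<^sub>C F)"
      using le[of "inverse c" "c *\<^sub>C F"] by (simp add: norm_inverse)
    then have "cmod c * norm F \<le> norm (c *\<^sub>C F)"
      using False by (simp add: field_simps)
    then show ?thesis using le[of c F] by simp
  qed
qed

end

definition bounded_ops :: "('a::complex_normed_vector \<Rightarrow>\<^sub>L 'a) set" where
  "bounded_ops = {F. \<forall>c x. blinfun_apply F (c *\<^sub>C x) = c *\<^sub>C blinfun_apply F x}"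

definition compact_ops :: "('a::complex_normed_vector \<Rightarrow>\<^sub>L 'a) set" where
  "compact_ops = {F \<in> bounded_ops. compact (closure (blinfun_apply F ` cball 0 1))}"

definition invertible_op :: "('a::complex_normed_vector \<Rightarrow>\<^sub>L 'a) \<Rightarrow> bool" where
  "invertible_op W \<longleftrightarrow> W \<in> bounded_ops \<and>
     (\<exists>V\<in>bounded_ops. W o\<^sub>L V = id_blinfun \<and> V o\<^sub>L W = id_blinfun)"

definition inverse_op :: "('a::complex_normed_vector \<Rightarrow>\<^sub>L 'a) \<Rightarrow> 'a \<Rightarrow>\<^sub>L 'a" where
  "inverse_op W = (THE V. V \<in> bounded_ops \<and> W o\<^sub>L V = id_blinfun \<and> V o\<^sub>L W = id_blinfun)"

primrec power_op :: "('a::complex_normed_vector \<Rightarrow>\<^sub>L 'a) \<Rightarrow> nat \<Rightarrow> 'a \<Rightarrow>\<^sub>L 'a" where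
  "power_op W 0 = id_blinfun"
| "power_op W (Suc n) = W o\<^sub>L power_op W n"

definition is_adjoint :: "('a::complex_inner \<Rightarrow>\<^sub>L 'a) \<Rightarrow> ('a \<Rightarrow>\<^sub>L 'a) \<Rightarrow> bool" where
  "is_adjoint V U \<longleftrightarrow>
     (\<forall>x y. cinner (blinfun_apply U x) y = cinner x (blinfun_apply V y))"

text \<open>\<open>V\<close> below is the adjoint of \<open>U\<close>, which is unique.\<close>

definition unitary_op :: "('a::complex_inner \<Rightarrow>\<^sub>L 'a) \<Rightarrow> bool" where
  "unitary_op U \<longleftrightarrow> U \<in> bounded_ops \<and>
     (\<exists>V\<in>bounded_ops. is_adjoint V U \<and> U o\<^sub>L V = id_blinfun \<and> V o\<^sub>L U = id_blinfun)"

definition is_orthogonal_projection :: "('a::complex_inner \<Rightarrow>\<^sub>L 'a) \<Rightarrow> 'a set \<Rightarrow> bool" where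
  "is_orthogonal_projection P M \<longleftrightarrow> P \<in> bounded_ops \<and>
     (\<forall>x. blinfun_apply P x \<in> M \<and> (\<forall>y\<in>M. cinner (x - blinfun_apply P x) y = 0))"


section \<open>Chaotic operators\<close>

text \<open>The Banach space is a closed subspace \<open>X\<close> of an ambient normed space; its
  open sets are the relatively open ones, and only the values of operators on \<open>X\<close> matter.\<close>

definition bounded_operator_on ::
    "'b::complex_normed_vector set \<Rightarrow> ('b \<Rightarrow> 'b) \<Rightarrow> bool" where
  "bounded_operator_on X T \<longleftrightarrow>
     (\<forall>x\<in>X. T x \<in> X) \<and>
     (\<forall>x\<in>X. \<forall>y\<in>X. T (x + y) = T x + T y) \<and>
     (\<forall>c. \<forall>x\<in>X. T (c *\<^sub>C x) = c *\<^sub>C T x) \<and>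
     (\<exists>K. \<forall>x\<in>X. norm (T x) \<le> K * norm x)"

definition topologically_transitive_on ::
    "'b::complex_normed_vector set \<Rightarrow> (nat \<Rightarrow> 'b \<Rightarrow> 'b) \<Rightarrow> bool" where
  "topologically_transitive_on X T \<longleftrightarrow>
     (\<forall>A B. openin (top_of_set X) A \<and> openin (top_of_set X) B \<and> A \<noteq> {} \<and> B \<noteq> {} \<longrightarrow>
        (\<exists>n\<ge>1. T n ` A \<inter> B \<noteq> {}))"

definition periodic_elements_on ::
    "'b::complex_normed_vector set \<Rightarrow> (nat \<Rightarrow> 'b \<Rightarrow> 'b) \<Rightarrow> 'b set" where
  "periodic_elements_on X T = {x \<in> X. \<exists>N\<ge>1. \<forall>k\<ge>1. T (k * N) x = x}"

definition chaotic_sequence_on ::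
    "'b::complex_normed_vector set \<Rightarrow> (nat \<Rightarrow> 'b \<Rightarrow> 'b) \<Rightarrow> bool" where
  "chaotic_sequence_on X T \<longleftrightarrow>
     (\<forall>n. bounded_operator_on X (T n)) \<and>
     topologically_transitive_on X T \<and>
     X \<subseteq> closure (periodic_elements_on X T)"

definition chaotic_on ::
    "'b::complex_normed_vector set \<Rightarrow> ('b \<Rightarrow> 'b) \<Rightarrow> bool" where
  "chaotic_on X T \<longleftrightarrow> bounded_operator_on X T \<and> chaotic_sequence_on X (\<lambda>n. T ^^ n)"

definition T_op ::
    "('a::complex_normed_vector \<Rightarrow>\<^sub>L 'a) \<Rightarrow> ('a \<Rightarrow>\<^sub>L 'a) \<Rightarrow> ('a \<Rightarrow>\<^sub>L 'a) \<Rightarrow> 'a \<Rightarrow>\<^sub>L 'a" where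
  "T_op U W F = W o\<^sub>L F o\<^sub>L U"

definition S_op ::
    "('a::complex_normed_vector \<Rightarrow>\<^sub>L 'a) \<Rightarrow> ('a \<Rightarrow>\<^sub>L 'a) \<Rightarrow> ('a \<Rightarrow>\<^sub>L 'a) \<Rightarrow> 'a \<Rightarrow>\<^sub>L 'a" where
  "S_op U W F = inverse_op W o\<^sub>L F o\<^sub>L inverse_op U"

end

theory Submission
  imports Defs
begin

text \<open>Every compact \<open>F\<close> is the norm limit of \<open>P m F\<close>. Since \<open>U\<close> is unitary, the \<open>N\<close>-th iterates at
  \<open>P m F\<close> are bounded by \<open>\<parallel>W\<^sup>N P m\<parallel> \<parallel>F\<parallel>\<close> and \<open>\<parallel>W\<^sup>-\<^sup>N P m\<parallel> \<parallel>F\<parallel>\<close>, so the hypothesis makes both series of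
  iterates along multiples of some \<open>N\<close> absolutely summable with arbitrarily small sums. With \<open>T\<close> for
  the operator and \<open>S\<close> for its inverse, \<open>P m F + S\<^sup>N (P m G)\<close> is then close to \<open>F\<close> and is mapped by
  \<open>T\<^sup>N\<close> close to \<open>G\<close>, and the sum of the orbit of \<open>P m F\<close> under all powers \<open>T\<^sup>l\<^sup>N\<close>, \<open>l \<in> \<int>\<close>, is a
  periodic element close to \<open>F\<close>.\<close>

section \<open>A chaos criterion for invertible operators\<close>

lemma bounded_operator_on_funpow:
  assumes "bounded_operator_on X T"
  shows "bounded_operator_on X (T ^^ n)"
proof (induction n)
  case 0
  show ?case
    unfolding bounded_operator_on_def by (auto intro: exI[of _ 1])
next
  case (Suc n)
  obtain K where K: "\<forall>x\<in>X. norm (T x) \<le> K * norm x"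
    using assms unfolding bounded_operator_on_def by blast
  obtain L where L: "\<forall>x\<in>X. norm ((T ^^ n) x) \<le> L * norm x"
    using Suc unfolding bounded_operator_on_def by blast
  \<comment> \<open>The sign of \<open>K\<close> is unknown, so \<open>\<bar>K\<bar>\<close> is
    taken to make multiplication by it monotone.\<close>
  have "norm (T ((T ^^ n) x)) \<le> \<bar>K\<bar> * L * norm x" if "x \<in> X" for x
  proof -
    have "norm (T ((T ^^ n) x)) \<le> K * norm ((T ^^ n) x)"
      using K Suc that unfolding bounded_operator_on_def by blast
    also have "\<dots> \<le> \<bar>K\<bar> * norm ((T ^^ n) x)"
      by (intro mult_right_mono) auto
    also have "\<dots> \<le> \<bar>K\<bar> * (L * norm x)"
      using L that by (intro mult_left_mono) auto
    finally show ?thesis by (simp add: mult.assoc)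
  qed
  then show ?case
    using assms Suc unfolding bounded_operator_on_def by (auto intro: exI[of _ "\<bar>K\<bar> * L"])
qed

lemma bounded_operator_on_closed: "bounded_operator_on X T \<Longrightarrow> x \<in> X \<Longrightarrow> T x \<in> X"
  and bounded_operator_on_add:
    "bounded_operator_on X T \<Longrightarrow> x \<in> X \<Longrightarrow> y \<in> X \<Longrightarrow> T (x + y) = T x + T y"
  unfolding bounded_operator_on_def by auto

lemma bounded_operator_on_diff:
  assumes "csubspace X" "bounded_operator_on X T" "x \<in> X" "y \<in> X"
  shows "T (x - y) = T x - T y"
proof -
  have "T (x - y) + T y = T (x - y + y)"
    using assms by (intro bounded_operator_on_add[symmetric]) (auto intro: complex_vector.subspace_diff)
  then show ?thesis by (simp add: algebra_simps)
qed

text \<open>\<open>T\<close> is linear and bounded only on \<open>X\<close>, so everything must stay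
  there: completeness of the ambient space gives the sum, closedness of \<open>X\<close> keeps it in
  \<open>X\<close>, and the norm bound carries additivity from partial sums to the limit.\<close>

lemma bounded_operator_on_suminf:
  fixes X :: "'b::{complex_normed_vector, banach} set"
  assumes X: "csubspace X" "closed X" and T: "bounded_operator_on X T"
    and a: "\<And>l. a l \<in> X" and sm: "summable (\<lambda>l. norm (a l))"
  shows "suminf a \<in> X" and "(\<lambda>l. T (a l)) sums T (suminf a)"
proof -
  have s: "a sums suminf a"
    using summable_norm_cancel[OF sm] by (rule summable_sums)
  have S: "sum a A \<in> X" for A
    using X a by (auto intro: complex_vector.subspace_sum)
  have TS: "T (sum a A) = (\<Sum>l\<in>A. T (a l))" if "finite A" for A
    using that
  proof (induction A)
    \<comment> \<open>\<open>T 0 = 0\<close> is read off from \<open>T (a 0 - a 0)\<close>.\<close>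
    case empty
    show ?case
      using bounded_operator_on_diff[OF X(1) T, of "a 0" "a 0"] a by simp
  next
    case (insert l A)
    then show ?case using bounded_operator_on_add[OF T a S] by simp
  qed
  show m: "suminf a \<in> X"
    by (rule closed_sequentially[OF X(2), of "\<lambda>n. sum a {..<n}"]) (use S s in \<open>simp_all add: sums_def\<close>)
  obtain K where K: "\<forall>x\<in>X. norm (T x) \<le> K * norm x"
    using T unfolding bounded_operator_on_def by blast
  have "(\<lambda>n. sum a {..<n} - suminf a) \<longlonglongrightarrow> 0"
    using s unfolding sums_def by (simp add: LIM_zero)
  then have "(\<lambda>n. K * norm (sum a {..<n} - suminf a)) \<longlonglongrightarrow> 0"
    using tendsto_mult_right_zero tendsto_norm_zero by blast
  moreover have "norm (T (sum a {..<n}) - T (suminf a)) \<le> K * norm (sum a {..<n} - suminf a)" for n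
    using K S m X by (simp add: bounded_operator_on_diff[OF X(1) T, symmetric]
        complex_vector.subspace_diff)
  ultimately have "(\<lambda>n. T (sum a {..<n}) - T (suminf a)) \<longlonglongrightarrow> 0"
    by (intro Lim_null_comparison[where f = "\<lambda>n. T (sum a {..<n}) - T (suminf a)"]) auto
  then show "(\<lambda>l. T (a l)) sums T (suminf a)"
    unfolding sums_def using TS by (simp add: LIM_zero_iff)
qed

lemma funpow_inverse_on:
  assumes "\<And>x. x \<in> X \<Longrightarrow> S (T x) = x" "\<And>x. x \<in> X \<Longrightarrow> T x \<in> X" "x \<in> X"
  shows "(S ^^ n) ((T ^^ n) x) = x"
proof (induction n)
  case (Suc n)
  have "(T ^^ n) x \<in> X"
    using assms by (induction n) auto
  then have "(S ^^ n) (S (T ((T ^^ n) x))) = x"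
    using Suc assms(1) by simp
  \<comment> \<open>One \<open>S\<close> is moved to the inside, where it meets the outermost
    \<open>T\<close>.\<close>
  then show ?case by (subst funpow_Suc_right) simp
qed simp

text \<open>The bilateral series \<open>\<Sum>l\<in>\<int>. R ^ l y\<close> is shifted onto itself by \<open>R\<close>.\<close>

lemma bilateral_series_fixed:
  fixes X :: "'b::{complex_normed_vector, banach} set"
  assumes X: "csubspace X" "closed X" and R: "bounded_operator_on X R" and Q: "bounded_operator_on X Q"
    and RQ: "\<And>x. x \<in> X \<Longrightarrow> R (Q x) = x" and y: "y \<in> X"
    and sR: "summable (\<lambda>l. norm ((R ^^ Suc l) y))" and sQ: "summable (\<lambda>l. norm ((Q ^^ Suc l) y))"
  defines "x \<equiv> y + (\<Sum>l. (R ^^ Suc l) y) + (\<Sum>l. (Q ^^ Suc l) y)"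
  shows "x \<in> X" "R x = x"
proof -
  define a b where "a = (\<lambda>l. (R ^^ Suc l) y)" and "b = (\<lambda>l. (Q ^^ Suc l) y)"
  have pow: "(R ^^ l) y \<in> X" "(Q ^^ l) y \<in> X" for l
    using bounded_operator_on_closed[OF bounded_operator_on_funpow] R Q y by blast+
  have ab: "a l \<in> X" "b l \<in> X" for l
    unfolding a_def b_def using pow by blast+
  have sa: "summable (\<lambda>l. norm (a l))" and sb: "summable (\<lambda>l. norm (b l))"
    using sR sQ unfolding a_def b_def .
  note A = bounded_operator_on_suminf[OF X R ab(1) sa]
  note B = bounded_operator_on_suminf[OF X R ab(2) sb]
  have x: "x = y + suminf a + suminf b"
    unfolding x_def a_def b_def ..
  show "x \<in> X"
    unfolding x using A(1) B(1) y X by (intro complex_vector.subspace_add)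
  \<comment> \<open>\<open>R\<close> shifts the forward half by one place, so the image loses the
    first term \<open>a 0 = R y\<close>.\<close>
  have "(\<lambda>l. a (Suc l)) sums (suminf a - a 0)"
    using summable_sums[OF summable_norm_cancel[OF sa]] by (simp add: sums_Suc_iff)
  then have Ra: "R (suminf a) = suminf a - R y"
    using A(2) sums_unique2 unfolding a_def by fastforce
  \<comment> \<open>On the backward half \<open>R\<close> undoes one \<open>Q\<close>, so the image
    gains the central term \<open>y\<close>. This gain and the loss of \<open>R y\<close> in the
    forward half balance the change from \<open>y\<close> to \<open>R y\<close> in the
    middle.\<close>
  have bS: "R (b (Suc l)) = b l" and b0: "R (b 0) = y" for l
    unfolding b_def using RQ pow(2)[of "Suc l"] y by auto
  have "(\<lambda>l. R (b (Suc l))) sums suminf b"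
    unfolding bS using summable_sums[OF summable_norm_cancel[OF sb]] .
  then have "(\<lambda>l. R (b l)) sums (suminf b + y)"
    using sums_Suc[of "\<lambda>l. R (b l)"] b0 by simp
  then have Rb: "R (suminf b) = suminf b + y"
    using B(2) sums_unique2 by blast
  have "R x = R y + R (suminf a) + R (suminf b)"
    unfolding x using A(1) B(1) y X complex_vector.subspace_add[OF X(1) y A(1)]
    by (simp add: bounded_operator_on_add[OF R])
  then show "R x = x"
    unfolding Ra Rb x by simp
qed

text \<open>One approximation hypothesis serves both halves of chaos. Transitivity uses two points
  and only the first term of each series; density of periodic elements uses one point and the full
  sums. The exponents start at \<open>Suc 0 * N\<close>, so the point itself is not counted among
  its small iterates.\<close>

lemma chaos_criterion:
  fixes X :: "'b::{complex_normed_vector, banach} set"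
  assumes X: "csubspace X" "closed X" and T: "bounded_operator_on X T" and S: "bounded_operator_on X S"
    and TS: "\<And>x. x \<in> X \<Longrightarrow> T (S x) = x"
    and approx: "\<And>x y \<epsilon>. x \<in> X \<Longrightarrow> y \<in> X \<Longrightarrow> \<epsilon> > 0 \<Longrightarrow>
      \<exists>x'\<in>X. \<exists>y'\<in>X. \<exists>N\<ge>1. dist x' x < \<epsilon> \<and> dist y' y < \<epsilon> \<and>
        (\<forall>z\<in>{x', y'}. \<forall>R\<in>{T, S}. summable (\<lambda>l. norm ((R ^^ (Suc l * N)) z)) \<and>
          (\<Sum>l. norm ((R ^^ (Suc l * N)) z)) < \<epsilon>)"
  shows "chaotic_on X T"
proof -
  have pow: "bounded_operator_on X (T ^^ n)" "bounded_operator_on X (S ^^ n)" for n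
    using bounded_operator_on_funpow T S by blast+
  have TSn: "(T ^^ n) ((S ^^ n) x) = x" if "x \<in> X" for n x
    using funpow_inverse_on[of X T S] TS bounded_operator_on_closed[OF S] that by blast
  have "topologically_transitive_on X (\<lambda>n. T ^^ n)"
    unfolding topologically_transitive_on_def
  proof (intro allI impI, elim conjE)
    fix A B
    assume A: "openin (top_of_set X) A" "A \<noteq> {}" and B: "openin (top_of_set X) B" "B \<noteq> {}"
    obtain x y where xy: "x \<in> A" "y \<in> B" using A B by blast
    have XAB: "A \<subseteq> X" "B \<subseteq> X"
      using A B by (auto dest: openin_imp_subset)
    obtain d1 where d1: "d1 > 0" "\<And>z. z \<in> X \<Longrightarrow> dist z x < d1 \<Longrightarrow> z \<in> A"
      using A xy unfolding openin_euclidean_subtopology_iff by blast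
    obtain d2 where d2: "d2 > 0" "\<And>z. z \<in> X \<Longrightarrow> dist z y < d2 \<Longrightarrow> z \<in> B"
      using B xy unfolding openin_euclidean_subtopology_iff by blast
    \<comment> \<open>Each of the two distances below is bounded by two terms smaller than
      \<open>\<epsilon>\<close>.\<close>
    define \<epsilon> where "\<epsilon> = min d1 d2 / 2"
    have "x \<in> X" "y \<in> X" "\<epsilon> > 0"
      using d1 d2 xy XAB unfolding \<epsilon>_def by auto
    from approx[OF this] obtain x' y' N
      where xy': "x' \<in> X" "y' \<in> X" "N \<ge> 1" "dist x' x < \<epsilon>" "dist y' y < \<epsilon>"
        and sm: "\<forall>z\<in>{x', y'}. \<forall>R\<in>{T, S}. summable (\<lambda>l. norm ((R ^^ (Suc l * N)) z)) \<and>
          (\<Sum>l. norm ((R ^^ (Suc l * N)) z)) < \<epsilon>"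
      by (elim bexE exE conjE) (rule that; assumption)
    \<comment> \<open>The iterate \<open>R ^^ N\<close> is the term \<open>l = 0\<close> of a series
      with nonnegative terms.\<close>
    have small: "norm ((R ^^ N) z) < \<epsilon>" if "z \<in> {x', y'}" "R \<in> {T, S}" for z R
    proof -
      have "norm ((R ^^ N) z) \<le> (\<Sum>l. norm ((R ^^ (Suc l * N)) z))"
        using sum_le_suminf[of "\<lambda>l. norm ((R ^^ (Suc l * N)) z)" "{0}"] sm that by auto
      then show ?thesis using sm that by fastforce
    qed
    define z where "z = x' + (S ^^ N) y'"
    have SX: "(S ^^ N) y' \<in> X" and TX: "(T ^^ N) x' \<in> X"
      using bounded_operator_on_closed pow xy' by blast+
    have "z \<in> A"
    proof (rule d1)
      show "z \<in> X" unfolding z_def using xy' SX X by (intro complex_vector.subspace_add)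
      have "dist z x \<le> dist x' x + norm ((S ^^ N) y')"
        unfolding z_def dist_norm using norm_triangle_ineq[of "x' - x" "(S ^^ N) y'"]
        by (simp add: algebra_simps)
      then show "dist z x < d1"
        using xy' small[of y' S] unfolding \<epsilon>_def by auto
    qed
    moreover have "(T ^^ N) z \<in> B"
    proof (rule d2)
      have Tz: "(T ^^ N) z = (T ^^ N) x' + y'"
        unfolding z_def using bounded_operator_on_add[OF pow(1) xy'(1) SX] TSn xy' by simp
      then show "(T ^^ N) z \<in> X"
        using TX xy' X by (auto intro: complex_vector.subspace_add)
      have "dist ((T ^^ N) z) y \<le> dist y' y + norm ((T ^^ N) x')"
        unfolding Tz dist_norm using norm_triangle_ineq[of "y' - y" "(T ^^ N) x'"]
        by (simp add: algebra_simps)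
      then show "dist ((T ^^ N) z) y < d2"
        using xy' small[of x' T] unfolding \<epsilon>_def by auto
    qed
    ultimately show "\<exists>n\<ge>1. (T ^^ n) ` A \<inter> B \<noteq> {}"
      using xy' by blast
  qed
  moreover have "X \<subseteq> closure (periodic_elements_on X (\<lambda>n. T ^^ n))"
  proof (intro subsetI, unfold closure_approachable, intro allI impI)
    fix y and \<epsilon> :: real
    assume y: "y \<in> X" and "\<epsilon> > 0"
    \<comment> \<open>The three thirds are for the distance from \<open>z\<close> to
      \<open>y\<close>, the forward sum and the backward sum. The criterion is used with
      \<open>y\<close> in both places, and only the first approximant enters.\<close>
    then have "\<epsilon> / 3 > 0" by simp
    from approx[OF y y this] obtain z z' N where z: "z \<in> X" "N \<ge> 1" "dist z y < \<epsilon> / 3"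
      and z': "\<forall>z\<in>{z, z'}. \<forall>R\<in>{T, S}. summable (\<lambda>l. norm ((R ^^ (Suc l * N)) z)) \<and>
          (\<Sum>l. norm ((R ^^ (Suc l * N)) z)) < \<epsilon> / 3"
      by (elim bexE exE conjE) (rule that; assumption)
    have sm: "summable (\<lambda>l. norm ((R ^^ (Suc l * N)) z)) \<and>
        (\<Sum>l. norm ((R ^^ (Suc l * N)) z)) < \<epsilon> / 3" if "R \<in> {T, S}" for R
      by (rule bspec[OF bspec[OF z'] that]) simp
    \<comment> \<open>Turns iterates along multiples of \<open>N\<close> into powers of a single
      map, as the bilateral series requires with \<open>T ^^ N\<close> and
      \<open>S ^^ N\<close>.\<close>
    have eq: "R ^^ (k * N) = (R ^^ N) ^^ k" for R :: "'b \<Rightarrow> 'b" and k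
      by (simp add: funpow_mult mult.commute)
    define x where "x = z + (\<Sum>l. ((T ^^ N) ^^ Suc l) z) + (\<Sum>l. ((S ^^ N) ^^ Suc l) z)"
    have x: "x \<in> X" "(T ^^ N) x = x"
      using bilateral_series_fixed[OF X pow(1)[of N] pow(2)[of N] TSn z(1)] sm[of T] sm[of S]
      unfolding x_def eq by auto
    have "(T ^^ (k * N)) x = x" for k
      unfolding eq using x(2) by (induction k) simp_all
    then have "x \<in> periodic_elements_on X (\<lambda>n. T ^^ n)"
      unfolding periodic_elements_on_def using x(1) z(2) by (auto intro!: exI[of _ N])
    moreover have "dist x y < \<epsilon>"
    proof -
      have s: "norm (\<Sum>l. ((R ^^ N) ^^ Suc l) z) < \<epsilon> / 3" if "R \<in> {T, S}" for R
        using summable_norm[of "\<lambda>l. ((R ^^ N) ^^ Suc l) z"] sm[OF that] unfolding eq by (meson le_less_trans)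
      have "x - y = (z - y) + (\<Sum>l. ((T ^^ N) ^^ Suc l) z) + (\<Sum>l. ((S ^^ N) ^^ Suc l) z)"
        unfolding x_def by simp
      also have "norm \<dots> \<le> norm (z - y) + norm (\<Sum>l. ((T ^^ N) ^^ Suc l) z)
          + norm (\<Sum>l. ((S ^^ N) ^^ Suc l) z)"
        by (rule norm_triangle_mono[OF norm_triangle_ineq order_refl])
      also have "\<dots> < \<epsilon> / 3 + \<epsilon> / 3 + \<epsilon> / 3"
        using s z(3) unfolding dist_norm by (intro add_strict_mono) simp_all
      finally show ?thesis unfolding dist_norm by simp
    qed
    ultimately show "\<exists>x\<in>periodic_elements_on X (\<lambda>n. T ^^ n). dist x y < \<epsilon>" by blast
  qed
  ultimately show ?thesis
    unfolding chaotic_on_def chaotic_sequence_on_def using T pow by blast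
qed

section \<open>Compact operators\<close>

lemma blinfun_compose_assoc: "(F o\<^sub>L G) o\<^sub>L H = F o\<^sub>L (G o\<^sub>L H)"
  by (rule blinfun_eqI) simp

lemma blinfun_compose_id: "F o\<^sub>L id_blinfun = F" "id_blinfun o\<^sub>L F = F"
  by (auto intro: blinfun_eqI)

lemma bounded_ops_compose: "F \<in> bounded_ops \<Longrightarrow> G \<in> bounded_ops \<Longrightarrow> F o\<^sub>L G \<in> bounded_ops"
  unfolding bounded_ops_def by simp

lemma compact_ops_imp_bounded_ops: "F \<in> compact_ops \<Longrightarrow> F \<in> bounded_ops"
  unfolding compact_ops_def by simp

lemma compact_closure_subset:
  fixes K :: "'a::metric_space set"
  assumes "compact K" "S \<subseteq> K"
  shows "compact (closure S)"
proof -
  have "closure S \<subseteq> K"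
    using assms by (intro closure_minimal compact_imp_closed)
  then show ?thesis
    using compact_Int_closed[OF assms(1) closed_closure[of S]] by (simp add: Int_absorb1)
qed

text \<open>A finite cover of \<open>S\<close> by balls of half the radius gives a closed finite
  union of closed balls, which therefore covers the closure too; completeness then turns total
  boundedness into compactness. This supplies the finite nets for the limit arguments on compact
  operators.\<close>

lemma compact_closure_iff_totally_bounded:
  fixes S :: "'a::{complete_space} set"
  shows "compact (closure S) \<longleftrightarrow> (\<forall>\<epsilon>>0. \<exists>k. finite k \<and> S \<subseteq> (\<Union>x\<in>k. ball x \<epsilon>))"
proof
  assume "compact (closure S)"
  then show "\<forall>\<epsilon>>0. \<exists>k. finite k \<and> S \<subseteq> (\<Union>x\<in>k. ball x \<epsilon>)"
    unfolding compact_eq_totally_bounded using closure_subset[of S] by (meson subset_trans)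
next
  assume tb: "\<forall>\<epsilon>>0. \<exists>k. finite k \<and> S \<subseteq> (\<Union>x\<in>k. ball x \<epsilon>)"
  have "\<exists>k. finite k \<and> closure S \<subseteq> (\<Union>x\<in>k. ball x \<epsilon>)" if \<epsilon>: "\<epsilon> > 0" for \<epsilon>
  proof -
    obtain k where k: "finite k" "S \<subseteq> (\<Union>x\<in>k. ball x (\<epsilon> / 2))"
      using tb[rule_format, OF half_gt_zero[OF \<epsilon>]] by blast
    have "closure S \<subseteq> (\<Union>x\<in>k. cball x (\<epsilon> / 2))"
    proof (rule closure_minimal)
      show "S \<subseteq> (\<Union>x\<in>k. cball x (\<epsilon> / 2))"
        using k(2) UN_mono[OF order_refl ball_subset_cball] by (rule order_trans)
      show "closed (\<Union>x\<in>k. cball x (\<epsilon> / 2))"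
        using k(1) by (intro closed_UN) auto
    qed
    also have "\<dots> \<subseteq> (\<Union>x\<in>k. ball x \<epsilon>)"
      using \<epsilon> by (intro UN_mono) auto
    finally show ?thesis using k by blast
  qed
  then show "compact (closure S)"
    unfolding compact_eq_totally_bounded by (simp add: complete_eq_closed)
qed

lemma bounded_linear_scaleC: "bounded_linear (\<lambda>y::'b::complex_normed_vector. c *\<^sub>C y)"
  by (rule bounded_linear_intro[where K = "cmod c"])
    (simp_all add: scaleC_add_right scaleR_scaleC scaleC_scaleC norm_scaleC mult.commute)

text \<open>\<open>H\<close> maps the unit ball into a ball of radius \<open>r\<close>, so the image
  under the product lies in a continuous image of the compact set belonging to
  \<open>F\<close>.\<close>

lemma compact_ops_compose:
  fixes F G H :: "'a::complex_normed_vector \<Rightarrow>\<^sub>L 'a"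
  assumes F: "F \<in> compact_ops" and G: "G \<in> bounded_ops" and H: "H \<in> bounded_ops"
  shows "G o\<^sub>L F o\<^sub>L H \<in> compact_ops"
proof -
  let ?K = "closure (blinfun_apply F ` cball 0 1)"
  \<comment> \<open>The added 1 keeps the divisor positive even if \<open>H = 0\<close>.\<close>
  define r where "r = norm H + 1"
  have r: "r > 0" unfolding r_def by (simp add: add_nonneg_pos)
  have "compact ?K" using F unfolding compact_ops_def by simp
  then have "compact ((\<lambda>y. blinfun_apply G (r *\<^sub>R y)) ` ?K)"
    by (intro compact_continuous_image continuous_intros)
  moreover have "blinfun_apply (G o\<^sub>L F o\<^sub>L H) ` cball 0 1 \<subseteq> (\<lambda>y. blinfun_apply G (r *\<^sub>R y)) ` ?K"
  proof
    fix z assume "z \<in> blinfun_apply (G o\<^sub>L F o\<^sub>L H) ` cball 0 1"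
    then obtain x where x: "norm x \<le> 1" "z = G (F (H x))" by auto
    have "norm (H x) \<le> norm H * 1"
      using norm_blinfun[of H x] mult_left_mono[OF x(1), of "norm H"] by simp
    then have "(1 / r) *\<^sub>R H x \<in> cball 0 1"
      using r unfolding r_def by (simp add: field_simps)
    then have "F ((1 / r) *\<^sub>R H x) \<in> ?K"
      by (intro subsetD[OF closure_subset] imageI)
    moreover have "z = G (r *\<^sub>R F ((1 / r) *\<^sub>R H x))"
      using r x by (simp add: blinfun.scaleR_right)
    ultimately show "z \<in> (\<lambda>y. blinfun_apply G (r *\<^sub>R y)) ` ?K" by blast
  qed
  ultimately have "compact (closure (blinfun_apply (G o\<^sub>L F o\<^sub>L H) ` cball 0 1))"
    by (rule compact_closure_subset)
  then show ?thesis
    using F G H unfolding compact_ops_def by (auto intro: bounded_ops_compose)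
qed

text \<open>Sums and scalar multiples of compact sets are compact, and they contain the images of
  the unit ball under \<open>F + G\<close> and \<open>c *\<^sub>C F\<close>.\<close>

lemma csubspace_compact_ops: "csubspace (compact_ops :: ('a::complex_normed_vector \<Rightarrow>\<^sub>L 'a) set)"
proof (rule complex_vector.subspaceI)
  have "closure (blinfun_apply (0 :: 'a \<Rightarrow>\<^sub>L 'a) ` cball 0 1) = {0}"
    by (simp add: image_constant_conv)
  then show "(0 :: 'a \<Rightarrow>\<^sub>L 'a) \<in> compact_ops"
    unfolding compact_ops_def bounded_ops_def
    by (auto simp: complex_vector.scale_zero_right)
next
  fix F G :: "'a \<Rightarrow>\<^sub>L 'a"
  assume FG: "F \<in> compact_ops" "G \<in> compact_ops"
  let ?K = "\<lambda>F. closure (blinfun_apply F ` cball 0 1)"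
  have "compact {x + y | x y. x \<in> ?K F \<and> y \<in> ?K G}"
    using FG unfolding compact_ops_def by (intro compact_sums) auto
  moreover have "blinfun_apply (F + G) ` cball 0 1 \<subseteq> {x + y | x y. x \<in> ?K F \<and> y \<in> ?K G}"
  proof (rule image_subsetI)
    fix u :: 'a
    assume u: "u \<in> cball 0 1"
    then have "F u \<in> ?K F" "G u \<in> ?K G"
      by (auto intro: subsetD[OF closure_subset])
    then show "(F + G) u \<in> {x + y | x y. x \<in> ?K F \<and> y \<in> ?K G}"
      unfolding blinfun.add_left by blast
  qed
  ultimately have "compact (?K (F + G))"
    by (rule compact_closure_subset)
  then show "F + G \<in> compact_ops"
    using FG unfolding compact_ops_def bounded_ops_def
    by (simp add: blinfun.add_left scaleC_add_right)
next
  fix c and F :: "'a \<Rightarrow>\<^sub>L 'a"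
  assume F: "F \<in> compact_ops"
  let ?K = "\<lambda>F. closure (blinfun_apply F ` cball 0 1)"
  have "compact ((\<lambda>y. c *\<^sub>C y) ` ?K F)"
    using F unfolding compact_ops_def
    by (intro compact_continuous_image bounded_linear.continuous_on[OF bounded_linear_scaleC]) auto
  moreover have "blinfun_apply (c *\<^sub>C F) ` cball 0 1 \<subseteq> (\<lambda>y. c *\<^sub>C y) ` ?K F"
    using closure_subset[of "blinfun_apply F ` cball 0 1"] by (auto simp: scaleC_blinfun.rep_eq)
  ultimately have "compact (?K (c *\<^sub>C F))"
    by (rule compact_closure_subset)
  then show "c *\<^sub>C F \<in> compact_ops"
    using F unfolding compact_ops_def bounded_ops_def
    by (simp add: scaleC_blinfun.rep_eq scaleC_scaleC mult.commute)
qed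

text \<open>For fixed \<open>c\<close> and \<open>x\<close>, complex homogeneity is an equation
  between continuous functions of \<open>F\<close>.\<close>

lemma closed_bounded_ops: "closed (bounded_ops :: ('a::complex_normed_vector \<Rightarrow>\<^sub>L 'a) set)"
proof -
  have "bounded_ops = (\<Inter>c. \<Inter>x. {F :: 'a \<Rightarrow>\<^sub>L 'a. F (c *\<^sub>C x) = c *\<^sub>C F x})"
    unfolding bounded_ops_def by auto
  moreover have "closed {F :: 'a \<Rightarrow>\<^sub>L 'a. F (c *\<^sub>C x) = c *\<^sub>C F x}" for c x
    by (intro closed_Collect_eq continuous_intros
        bounded_linear.continuous_on[OF bounded_linear_scaleC])
  ultimately show ?thesis by (metis (no_types, lifting) closed_INT)
qed

text \<open>Norm convergence is uniform on the unit ball, so a finite net of radius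
  \<open>\<epsilon> / 2\<close> for the image under a close \<open>F n\<close> is a net of radius
  \<open>\<epsilon>\<close> for the image under the limit.\<close>

lemma closed_compact_ops:
  "closed (compact_ops :: ('a::{complex_normed_vector, banach} \<Rightarrow>\<^sub>L 'a) set)"
proof (rule closed_sequential_limits[THEN iffD2], intro allI impI, elim conjE)
  fix F :: "nat \<Rightarrow> 'a \<Rightarrow>\<^sub>L 'a" and G
  assume F: "\<forall>n. F n \<in> compact_ops" and lim: "F \<longlonglongrightarrow> G"
  have "G \<in> bounded_ops"
    using closed_sequentially[OF closed_bounded_ops] F lim compact_ops_imp_bounded_ops by blast
  moreover have "\<exists>k. finite k \<and> blinfun_apply G ` cball 0 1 \<subseteq> (\<Union>x\<in>k. ball x \<epsilon>)" if \<epsilon>: "\<epsilon> > 0" for \<epsilon>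
  proof -
    obtain n where n: "norm (F n - G) < \<epsilon> / 2"
      using LIMSEQ_D[OF lim half_gt_zero[OF \<epsilon>]] by blast
    have "compact (closure (blinfun_apply (F n) ` cball 0 1))"
      using F unfolding compact_ops_def by simp
    then obtain k where k: "finite k" "blinfun_apply (F n) ` cball 0 1 \<subseteq> (\<Union>x\<in>k. ball x (\<epsilon> / 2))"
      unfolding compact_closure_iff_totally_bounded using half_gt_zero[OF \<epsilon>] by meson
    have "G u \<in> (\<Union>x\<in>k. ball x \<epsilon>)" if u: "norm u \<le> 1" for u
    proof -
      obtain x where x: "x \<in> k" "dist x (F n u) < \<epsilon> / 2"
        using k u by (force simp: image_subset_iff)
      have "dist (F n u) (G u) \<le> norm (F n - G) * norm u"
        unfolding dist_norm blinfun.diff_left[symmetric] by (rule norm_blinfun)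
      also have "\<dots> \<le> norm (F n - G)"
        using u by (simp add: mult_left_le)
      finally have "dist x (G u) < \<epsilon>"
        using n x dist_triangle[of x "G u" "F n u"] by linarith
      then show ?thesis using x by auto
    qed
    then show ?thesis using k by (intro exI[of _ k]) auto
  qed
  ultimately show "G \<in> compact_ops"
    unfolding compact_ops_def by (simp add: compact_closure_iff_totally_bounded)
qed

text \<open>Pointwise convergence is uniform on a finite net of the image of the unit ball under
  \<open>F\<close>, and the common bound 1 on the norms of \<open>P m\<close> extends this to the
  whole image.\<close>

lemma tendsto_compose_compact_op:
  fixes P :: "nat \<Rightarrow> 'a::{complex_normed_vector, banach} \<Rightarrow>\<^sub>L 'a"
  assumes P1: "\<And>m. norm (P m) \<le> 1" and P: "\<And>x. (\<lambda>m. P m x) \<longlonglongrightarrow> x"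
    and F: "F \<in> compact_ops"
  shows "(\<lambda>m. P m o\<^sub>L F) \<longlonglongrightarrow> F"
proof (rule LIMSEQ_I)
  fix r :: real assume "r > 0"
  \<comment> \<open>The three terms of the splitting through a net point give
    \<open>3 * \<epsilon>\<close>; a quarter of \<open>r\<close> leaves the operator norm strictly
    below \<open>r\<close>.\<close>
  define \<epsilon> where "\<epsilon> = r / 4"
  have \<epsilon>: "\<epsilon> > 0" using \<open>r > 0\<close> unfolding \<epsilon>_def by simp
  have "compact (closure (blinfun_apply F ` cball 0 1))"
    using F unfolding compact_ops_def by simp
  then obtain k where k: "finite k" "blinfun_apply F ` cball 0 1 \<subseteq> (\<Union>x\<in>k. ball x \<epsilon>)"
    unfolding compact_closure_iff_totally_bounded using \<epsilon> by meson
  have "eventually (\<lambda>m. \<forall>x\<in>k. dist (P m x) x < \<epsilon>) sequentially"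
    using k(1) tendstoD[OF P \<epsilon>] by (intro eventually_ball_finite) auto
  then obtain M where M: "\<And>m x. m \<ge> M \<Longrightarrow> x \<in> k \<Longrightarrow> norm (P m x - x) < \<epsilon>"
    unfolding eventually_sequentially dist_norm by blast
  have "norm ((P m o\<^sub>L F) - F) < r" if m: "m \<ge> M" for m
  proof -
    have unit: "norm (((P m o\<^sub>L F) - F) u) \<le> 3 * \<epsilon>" if u: "norm u \<le> 1" for u
    proof -
      obtain x where x: "x \<in> k" "norm (x - F u) < \<epsilon>"
        using k u by (force simp: image_subset_iff dist_norm)
      have "norm (P m (F u - x)) \<le> norm (P m) * norm (F u - x)"
        by (rule norm_blinfun)
      also have "\<dots> \<le> norm (F u - x)"
        using P1[of m] by (simp add: mult_left_le_one_le)
      finally have "norm (P m (F u - x)) < \<epsilon>"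
        using x by (simp add: norm_minus_commute)
      moreover have "((P m o\<^sub>L F) - F) u = P m (F u - x) + (P m x - x) + (x - F u)"
        by (simp add: blinfun.diff_left blinfun.diff_right algebra_simps)
      ultimately show ?thesis
        using M[OF m x(1)] x(2) norm_triangle_ineq[of "P m (F u - x) + (P m x - x)" "x - F u"]
          norm_triangle_ineq[of "P m (F u - x)" "P m x - x"] by simp
    qed
    have "norm ((P m o\<^sub>L F) - F) \<le> 3 * \<epsilon>"
    proof (rule norm_blinfun_bound)
      fix u
      show "norm (((P m o\<^sub>L F) - F) u) \<le> 3 * \<epsilon> * norm u"
      proof (cases "u = 0")
        case False
        have "norm (((P m o\<^sub>L F) - F) ((1 / norm u) *\<^sub>R u)) \<le> 3 * \<epsilon>"
          using False by (intro unit) simp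
        then show ?thesis
          using False unfolding blinfun.scaleR_right by (simp add: field_simps)
      qed simp
    qed (use \<epsilon> in simp)
    then show ?thesis using \<open>r > 0\<close> unfolding \<epsilon>_def by simp
  qed
  then show "\<exists>M. \<forall>m\<ge>M. norm ((P m o\<^sub>L F) - F) < r" by blast
qed

section \<open>Orthogonal projections\<close>

lemma cinner_add_right: "cinner x (y + z) = cinner x y + cinner x z"
  using cinner_add_left[of y z x] by (metis cinner_commute complex_cnj_add)

lemma power2_norm_eq_cinner: "(norm x)\<^sup>2 = Re (cinner x x)"
  by (simp add: norm_eq_sqrt_cinner cinner_ge_zero)

text \<open>The vector \<open>x - P x\<close> lies in \<open>M\<close> and is orthogonal to
  \<open>M\<close>, hence to itself.\<close>

lemma orthogonal_projection_fixes:
  assumes P: "is_orthogonal_projection P M" and M: "csubspace M" and x: "x \<in> M"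
  shows "P x = x"
proof -
  have "x - P x \<in> M"
    using P M x unfolding is_orthogonal_projection_def by (auto intro: complex_vector.subspace_diff)
  then have "cinner (x - P x) (x - P x) = 0"
    using P unfolding is_orthogonal_projection_def by blast
  then show ?thesis by (simp add: cinner_eq_zero_iff)
qed

text \<open>Pythagoras for the orthogonal splitting of \<open>x\<close> into \<open>P x\<close> and
  \<open>x - P x\<close>.\<close>

lemma norm_orthogonal_projection:
  assumes P: "is_orthogonal_projection P M"
  shows "norm P \<le> 1"
proof (rule norm_blinfun_bound)
  fix x
  define y z where "y = P x" and "z = x - P x"
  have zy: "cinner z y = 0"
    using P unfolding is_orthogonal_projection_def y_def z_def by blast
  then have "cinner y z = 0"
    by (metis cinner_commute complex_cnj_zero)
  then have "cinner (y + z) (y + z) = cinner y y + cinner z z"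
    using zy by (simp add: cinner_add_left cinner_add_right)
  then have "(norm (y + z))\<^sup>2 = (norm y)\<^sup>2 + (norm z)\<^sup>2"
    by (simp add: power2_norm_eq_cinner)
  then have "(norm y)\<^sup>2 \<le> (norm (y + z))\<^sup>2" by simp
  then have "norm y \<le> norm (y + z)"
    by (rule power2_le_imp_le) simp
  then show "norm (P x) \<le> 1 * norm x"
    unfolding y_def z_def by simp
qed simp

text \<open>Finite linear combinations of basis vectors are dense, and each is fixed by
  \<open>P m\<close> once \<open>m\<close> reaches all its indices; the norm bound on
  \<open>P m\<close> controls the remaining error.\<close>

lemma orthonormal_basis_projections_tendsto:
  fixes e :: "nat \<Rightarrow> 'a::complex_inner" and P :: "nat \<Rightarrow> 'a \<Rightarrow>\<^sub>L 'a"
  assumes e: "orthonormal_basis e {1..}"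
    and P: "\<And>m. m \<ge> 1 \<Longrightarrow> is_orthogonal_projection (P m) (cspan (e ` {1..m}))"
  shows "(\<lambda>m. P m x) \<longlonglongrightarrow> x"
proof (rule LIMSEQ_I)
  fix r :: real assume r: "r > 0"
  have "x \<in> closure (cspan (e ` {1..}))"
    using e unfolding orthonormal_basis_def by simp
  then obtain y where y: "y \<in> cspan (e ` {1..})" "norm (y - x) < r / 2"
    unfolding closure_approachable dist_norm using r half_gt_zero by blast
  obtain t f where t: "finite t" "t \<subseteq> e ` {1..}" and yt: "y = (\<Sum>a\<in>t. f a *\<^sub>C a)"
    using y(1) unfolding complex_vector.span_explicit by blast
  obtain J where J: "finite J" "J \<subseteq> {1..}" "t = e ` J"
    using finite_subset_image[OF t] by blast
  obtain m0 where m0: "\<And>j. j \<in> J \<Longrightarrow> j \<le> m0"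
    using J(1) unfolding finite_nat_set_iff_bounded_le by blast
  \<comment> \<open>Starting at \<open>Suc m0\<close> also ensures \<open>m \<ge> 1\<close>, where
    \<open>P m\<close> is known to be a projection.\<close>
  have "norm (P m x - x) < r" if m: "m \<ge> Suc m0" for m
  proof -
    have "t \<subseteq> e ` {1..m}"
      unfolding J(3) using J(2) m0 m by (intro image_mono) force
    then have "y \<in> cspan (e ` {1..m})"
      unfolding yt by (intro complex_vector.span_sum complex_vector.span_scale
          complex_vector.span_base) auto
    then have Py: "P m y = y"
      using orthogonal_projection_fixes[OF P] m by (simp add: complex_vector.subspace_span)
    have "norm (P m (x - y)) \<le> norm (P m) * norm (x - y)"
      by (rule norm_blinfun)
    also have "\<dots> \<le> norm (x - y)"
      using norm_orthogonal_projection[OF P[of m]] m by (simp add: mult_left_le_one_le)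
    finally have "norm (P m (x - y)) < r / 2"
      using y by (simp add: norm_minus_commute)
    then have "norm (P m (x - y) + (y - x)) < r"
      using y(2) norm_triangle_ineq[of "P m (x - y)" "y - x"] by linarith
    then show ?thesis
      by (simp add: blinfun.diff_right Py)
  qed
  then show "\<exists>M. \<forall>m\<ge>M. norm (P m x - x) < r" by blast
qed

section \<open>Powers of two-sided multiplications\<close>

text \<open>Two-sided inverses are unique by associativity, which resolves the definite description
  in \<open>inverse_op\<close>.\<close>

lemma inverse_op_eq:
  assumes "V \<in> bounded_ops" "W o\<^sub>L V = id_blinfun" "V o\<^sub>L W = id_blinfun"
  shows "inverse_op W = V"
  unfolding inverse_op_def
proof (rule the_equality)
  fix V'
  assume "V' \<in> bounded_ops \<and> W o\<^sub>L V' = id_blinfun \<and> V' o\<^sub>L W = id_blinfun"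
  then have "V' o\<^sub>L W = id_blinfun" by blast
  with blinfun_compose_assoc[of V' W V] show "V' = V"
    using assms(2) by (simp add: blinfun_compose_id)
qed (use assms in blast)

text \<open>Moving \<open>U\<close> across the inner product cancels it against its adjoint, so
  \<open>U\<close> is isometric; its inverse is then isometric too.\<close>

lemma unitary_op_norm_le:
  assumes "unitary_op U"
  shows "norm U \<le> 1" "norm (inverse_op U) \<le> 1"
proof -
  obtain V where V: "V \<in> bounded_ops" "is_adjoint V U" "U o\<^sub>L V = id_blinfun" "V o\<^sub>L U = id_blinfun"
    using assms unfolding unitary_op_def by blast
  have VU: "V (U x) = x" and UV: "U (V x) = x" for x
    using V(3,4) by (metis blinfun_apply_blinfun_compose blinfun_apply_id_blinfun)+
  have "cinner (U x) (U x) = cinner x x" for x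
    using V(2) VU unfolding is_adjoint_def by simp
  then have iso: "norm (U x) = norm x" for x
    by (simp add: norm_eq_sqrt_cinner)
  then show "norm U \<le> 1"
    by (intro norm_blinfun_bound) auto
  have "norm (V x) = norm x" for x
    using iso[of "V x"] UV by simp
  then show "norm (inverse_op U) \<le> 1"
    unfolding inverse_op_eq[OF V(1,3,4)] by (intro norm_blinfun_bound) auto
qed

lemma norm_power_op_le_one:
  assumes "norm U \<le> 1"
  shows "norm (power_op U n) \<le> 1"
proof (induction n)
  case 0
  show ?case by (simp add: norm_blinfun_id_le)
next
  case (Suc n)
  have "norm (power_op U (Suc n)) \<le> norm U * norm (power_op U n)"
    by (simp add: norm_blinfun_compose)
  also have "\<dots> \<le> 1" using assms Suc by (simp add: mult_le_one)
  finally show ?case .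
qed

text \<open>\<open>power_op\<close> adds factors on the left, whereas iterating \<open>T_op\<close>
  adds \<open>U\<close> on the right.\<close>

lemma power_op_commute: "power_op U n o\<^sub>L U = U o\<^sub>L power_op U n"
proof (induction n)
  case (Suc n)
  then show ?case by (simp add: blinfun_compose_assoc)
qed (auto intro: blinfun_eqI)

lemma T_op_funpow: "(T_op U W ^^ n) F = power_op W n o\<^sub>L F o\<^sub>L power_op U n"
proof (induction n)
  case (Suc n)
  then show ?case
    by (simp add: T_op_def blinfun_compose_assoc power_op_commute)
qed (auto intro: blinfun_eqI)

text \<open>Lets all estimates for \<open>T_op\<close> be reused for \<open>S_op\<close>, with both
  operators replaced by their inverses.\<close>

lemma S_op_eq_T_op: "S_op U W = T_op (inverse_op U) (inverse_op W)"
  by (simp add: fun_eq_iff S_op_def T_op_def)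

text \<open>In the iterate \<open>P\<close> stands next to the power of \<open>W\<close> and is
  grouped with it, while the powers of the contraction \<open>U\<close> cost nothing.\<close>

lemma norm_T_op_funpow_le:
  assumes "norm U \<le> 1"
  shows "norm ((T_op U W ^^ n) (P o\<^sub>L F)) \<le> norm (power_op W n o\<^sub>L P) * norm F"
proof -
  have "norm ((T_op U W ^^ n) (P o\<^sub>L F)) = norm ((power_op W n o\<^sub>L P) o\<^sub>L F o\<^sub>L power_op U n)"
    by (simp add: T_op_funpow blinfun_compose_assoc)
  also have "\<dots> \<le> norm ((power_op W n o\<^sub>L P) o\<^sub>L F) * norm (power_op U n)"
    by (rule norm_blinfun_compose)
  also have "\<dots> \<le> norm ((power_op W n o\<^sub>L P) o\<^sub>L F)"
    using norm_power_op_le_one[OF assms] by (simp add: mult_left_le)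
  also have "\<dots> \<le> norm (power_op W n o\<^sub>L P) * norm F"
    by (rule norm_blinfun_compose)
  finally show ?thesis .
qed

lemma bounded_operator_on_T_op:
  assumes "U \<in> bounded_ops" "W \<in> bounded_ops"
  shows "bounded_operator_on compact_ops (T_op U W)"
  unfolding bounded_operator_on_def
proof (intro conjI ballI allI exI)
  fix F G :: "'a \<Rightarrow>\<^sub>L 'a" and c
  assume "F \<in> compact_ops"
  then show "T_op U W F \<in> compact_ops"
    unfolding T_op_def using assms by (intro compact_ops_compose)
  show "T_op U W (F + G) = T_op U W F + T_op U W G"
    by (rule blinfun_eqI) (simp add: T_op_def blinfun.add_left blinfun.add_right)
  show "T_op U W (c *\<^sub>C F) = c *\<^sub>C T_op U W F"
    using assms(2) by (intro blinfun_eqI) (simp add: T_op_def scaleC_blinfun.rep_eq bounded_ops_def)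
  have "norm (T_op U W F) \<le> norm (W o\<^sub>L F) * norm U"
    unfolding T_op_def by (rule norm_blinfun_compose)
  also have "\<dots> \<le> norm W * norm F * norm U"
    by (intro mult_right_mono norm_blinfun_compose) simp
  finally show "norm (T_op U W F) \<le> norm W * norm U * norm F"
    by (simp add: mult_ac)
qed

lemma T_op_inverse:
  assumes "W o\<^sub>L W' = id_blinfun" "U' o\<^sub>L U = id_blinfun"
  shows "T_op U W (T_op U' W' F) = F"
proof -
  have "W (W' x) = x" "U' (U x) = x" for x
    using assms by (metis blinfun_apply_blinfun_compose blinfun_apply_id_blinfun)+
  then show ?thesis by (intro blinfun_eqI) (simp add: T_op_def)
qed

text \<open>Termwise comparison, stated for arbitrary exponents \<open>n l\<close>; it is applied
  along multiples of one number.\<close>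

lemma T_op_series_le:
  assumes U: "norm U \<le> 1" and sm: "summable (\<lambda>l. norm (power_op W (n l) o\<^sub>L P))"
  shows "summable (\<lambda>l. norm ((T_op U W ^^ n l) (P o\<^sub>L F)))"
    and "(\<Sum>l. norm ((T_op U W ^^ n l) (P o\<^sub>L F))) \<le> (\<Sum>l. norm (power_op W (n l) o\<^sub>L P)) * norm F"
proof -
  note le = norm_T_op_funpow_le[OF U, where W = W and P = P and F = F]
  have s: "summable (\<lambda>l. norm (power_op W (n l) o\<^sub>L P) * norm F)"
    using sm by (rule summable_mult2)
  show s': "summable (\<lambda>l. norm ((T_op U W ^^ n l) (P o\<^sub>L F)))"
    by (rule summable_comparison_test'[OF s, of 0]) (use le in simp)
  show "(\<Sum>l. norm ((T_op U W ^^ n l) (P o\<^sub>L F))) \<le> (\<Sum>l. norm (power_op W (n l) o\<^sub>L P)) * norm F"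
    unfolding suminf_mult2[OF sm] by (rule suminf_le[OF le s' s])
qed

section \<open>Chaos of both multiplications on the compact operators\<close>

theorem theorem3p12:
  fixes e :: "nat \<Rightarrow> 'a::chilbert_space"
    and U W :: "'a \<Rightarrow>\<^sub>L 'a"
    and P :: "nat \<Rightarrow> 'a \<Rightarrow>\<^sub>L 'a"
  assumes "separable_space (euclidean :: 'a topology)"
    and "infinite_dimensional TYPE('a)"
    and "orthonormal_basis e {1..}"
    and "U \<in> bounded_ops" and "W \<in> bounded_ops"
    and "invertible_op W" and "unitary_op U"
    and "\<And>m. m \<ge> 1 \<Longrightarrow> is_orthogonal_projection (P m) (cspan (e ` {1..m}))"
    and "\<And>m. m \<ge> 1 \<Longrightarrow> \<exists>n :: nat \<Rightarrow> nat. strict_mono n \<and> (\<forall>k. n k \<ge> 1) \<and>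
        (\<forall>k. summable (\<lambda>l. norm (power_op W (Suc l * n k) o\<^sub>L P m))) \<and>
        (\<forall>k. summable (\<lambda>l. norm (power_op (inverse_op W) (Suc l * n k) o\<^sub>L P m))) \<and>
        (\<lambda>k. \<Sum>l. norm (power_op W (Suc l * n k) o\<^sub>L P m)) \<longlonglongrightarrow> 0 \<and>
        (\<lambda>k. \<Sum>l. norm (power_op (inverse_op W) (Suc l * n k) o\<^sub>L P m)) \<longlonglongrightarrow> 0"
  shows "chaotic_on compact_ops (T_op U W) \<and> chaotic_on compact_ops (S_op U W)"
proof -
  obtain W' where W': "W' \<in> bounded_ops" "W o\<^sub>L W' = id_blinfun" "W' o\<^sub>L W = id_blinfun"
    using assms(6) unfolding invertible_op_def by blast
  obtain U' where U': "U' \<in> bounded_ops" "U o\<^sub>L U' = id_blinfun" "U' o\<^sub>L U = id_blinfun"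
    using assms(7) unfolding unitary_op_def by blast
  have iW: "inverse_op W = W'" and iU: "inverse_op U = U'"
    using inverse_op_eq W' U' by blast+
  have norms: "norm U \<le> 1" "norm U' \<le> 1"
    using unitary_op_norm_le[OF assms(7)] unfolding iU .
  define T S where "T = T_op U W" and "S = T_op U' W'"
  have S_op: "S_op U W = S"
    unfolding S_op_eq_T_op iW iU S_def ..
  have T: "bounded_operator_on compact_ops T" and S: "bounded_operator_on compact_ops S"
    unfolding T_def S_def using bounded_operator_on_T_op assms(4,5) W' U' by blast+
  have TS: "T (S F) = F" and ST: "S (T F) = F" for F
    unfolding T_def S_def using T_op_inverse W' U' by blast+
  \<comment> \<open>The index is shifted because \<open>P 0\<close> is unconstrained.\<close>
  have tendsto: "(\<lambda>m. P (Suc m) o\<^sub>L F) \<longlonglongrightarrow> F" if "F \<in> compact_ops" for F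
  proof (rule tendsto_compose_compact_op[OF _ _ that])
    show "norm (P (Suc m)) \<le> 1" for m
      using norm_orthogonal_projection[OF assms(8)] by simp
    show "(\<lambda>m. P (Suc m) x) \<longlonglongrightarrow> x" for x
      using orthonormal_basis_projections_tendsto[OF assms(3,8)] by (rule LIMSEQ_Suc)
  qed
  have approx: "\<exists>F'\<in>compact_ops. \<exists>G'\<in>compact_ops. \<exists>N\<ge>1. dist F' F < \<epsilon> \<and> dist G' G < \<epsilon> \<and>
      (\<forall>H\<in>{F', G'}. \<forall>R\<in>{T, S}. summable (\<lambda>l. norm ((R ^^ (Suc l * N)) H)) \<and>
        (\<Sum>l. norm ((R ^^ (Suc l * N)) H)) < \<epsilon>)"
    if F: "F \<in> compact_ops" and G: "G \<in> compact_ops" and \<epsilon>: "\<epsilon> > 0" for F G \<epsilon>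
  proof -
    have "eventually (\<lambda>m. dist (P (Suc m) o\<^sub>L F) F < \<epsilon> \<and> dist (P (Suc m) o\<^sub>L G) G < \<epsilon>) sequentially"
      using tendstoD[OF tendsto \<epsilon>] F G by (intro eventually_conj) blast+
    then obtain m where m: "dist (P (Suc m) o\<^sub>L F) F < \<epsilon>" "dist (P (Suc m) o\<^sub>L G) G < \<epsilon>"
      unfolding eventually_sequentially by blast
    let ?P = "P (Suc m)"
    let ?s = "\<lambda>V N. \<Sum>l. norm (power_op V (Suc l * N) o\<^sub>L ?P)"
    obtain n :: "nat \<Rightarrow> nat" where n: "\<forall>k. n k \<ge> 1"
      and sm: "\<And>k. summable (\<lambda>l. norm (power_op W (Suc l * n k) o\<^sub>L ?P))"
        "\<And>k. summable (\<lambda>l. norm (power_op W' (Suc l * n k) o\<^sub>L ?P))"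
      and lim: "(\<lambda>k. ?s W (n k)) \<longlonglongrightarrow> 0" "(\<lambda>k. ?s W' (n k)) \<longlonglongrightarrow> 0"
      using assms(9)[of "Suc m"] unfolding iW by auto
    \<comment> \<open>\<open>C\<close> dominates both norms, so one threshold
      \<open>\<epsilon> / C\<close> serves \<open>F\<close> and \<open>G\<close>; the added 1 makes
      the division safe.\<close>
    define C where "C = norm F + norm G + 1"
    have C: "C > 0" unfolding C_def by (simp add: add_nonneg_pos)
    \<comment> \<open>Both limits run along the same sequence, so a single \<open>k\<close> makes
      the two sums small and \<open>n k\<close> can be the common step \<open>N\<close>.\<close>
    have "eventually (\<lambda>k. ?s W (n k) < \<epsilon> / C \<and> ?s W' (n k) < \<epsilon> / C) sequentially"
      using order_tendstoD(2)[OF lim(1), of "\<epsilon> / C"] order_tendstoD(2)[OF lim(2), of "\<epsilon> / C"] \<epsilon> C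
      by (intro eventually_conj) auto
    then obtain k where k: "?s W (n k) < \<epsilon> / C" "?s W' (n k) < \<epsilon> / C"
      unfolding eventually_sequentially by blast
    have series: "summable (\<lambda>l. norm ((T_op A V ^^ (Suc l * n k)) (?P o\<^sub>L H))) \<and>
        (\<Sum>l. norm ((T_op A V ^^ (Suc l * n k)) (?P o\<^sub>L H))) < \<epsilon>"
      if A: "norm A \<le> 1" and V: "summable (\<lambda>l. norm (power_op V (Suc l * n k) o\<^sub>L ?P))"
        "?s V (n k) < \<epsilon> / C" and H: "norm H \<le> C" for A V H
    proof -
      note le = T_op_series_le[OF A V(1), of H]
      have "?s V (n k) * norm H \<le> ?s V (n k) * C"
        using H V(1) by (intro mult_left_mono suminf_nonneg) auto
      also have "\<dots> < \<epsilon>"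
        using V(2) C by (simp add: pos_less_divide_eq)
      finally show ?thesis using le by linarith
    qed
    have PH: "?P o\<^sub>L H \<in> compact_ops" if "H \<in> compact_ops" for H
    proof -
      have "?P \<in> bounded_ops"
        using assms(8)[of "Suc m"] unfolding is_orthogonal_projection_def by simp
      \<comment> \<open>The identity is the right factor in the two-sided product rule for compact
        operators.\<close>
      moreover have "(id_blinfun :: 'a \<Rightarrow>\<^sub>L 'a) \<in> bounded_ops"
        unfolding bounded_ops_def by simp
      ultimately have "?P o\<^sub>L H o\<^sub>L id_blinfun \<in> compact_ops"
        by (intro compact_ops_compose that)
      then show ?thesis by (simp add: blinfun_compose_id)
    qed
    have "norm F \<le> C" "norm G \<le> C" unfolding C_def by simp_all
    then have small: "\<forall>H\<in>{?P o\<^sub>L F, ?P o\<^sub>L G}. \<forall>R\<in>{T, S}. summable (\<lambda>l. norm ((R ^^ (Suc l * n k)) H)) \<and>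
        (\<Sum>l. norm ((R ^^ (Suc l * n k)) H)) < \<epsilon>"
      unfolding T_def S_def ball_simps
      by (intro conjI TrueI series[OF norms(1) sm(1) k(1)] series[OF norms(2) sm(2) k(2)])
    then show ?thesis
      by (intro bexI[of _ "?P o\<^sub>L F"] bexI[of _ "?P o\<^sub>L G"] exI[of _ "n k"] conjI m n[rule_format]
          small PH F G)
  qed
  have "chaotic_on compact_ops T"
    by (rule chaos_criterion[OF csubspace_compact_ops closed_compact_ops T S TS approx])
  \<comment> \<open>\<open>approx\<close> is symmetric in \<open>T\<close> and \<open>S\<close>, so
    the criterion applies again with their roles exchanged.\<close>
  moreover have "chaotic_on compact_ops S"
    by (rule chaos_criterion[OF csubspace_compact_ops closed_compact_ops S T ST])
      (use approx in \<open>simp add: insert_commute\<close>)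
  ultimately show ?thesis
    unfolding S_op T_def by blast
qed

end
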